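(* Let $B$ be a unital C$^*$-algebra and let $A$ be a commutative C$^*$-subalgebra of $B$ containing the unit $1$ of $B$. Let $T : A \to B$ be a (bounded linear) local triple derivation. Then $T$ is a generalised derivation. Moreover, setting $\widetilde{T} := T - \frac12 \delta(T(1),1) = T - \delta\left(\frac12 T(1),1\right)$, the map $\widetilde{T} : A \to B$ is a local triple derivation with $\widetilde{T}(1) = 0$, and hence $\widetilde{T}$ is a derivation (and thus also a Jordan derivation).
   Context: $B$ is equipped with the triple product $\{a,b,c\} := \frac12(ab^*c + cb^*a)$, and is regarded as an $A$-bimodule via its own product. A (complex) linear map $\delta : A \to B$ is a triple derivation if $\delta\{a,b,c\} = \{\delta(a),b,c\} + \{a,\delta(b),c\} + \{a,b,\delta(c)\}$ for all $a,b,c\in A$. A bounded linear operator $T : A \to B$ is a local triple derivation if for each $a\in A$ there exists a triple derivation $\delta_a : A\to B$ with $T(a) = \delta_a(a)$. For $a,b\in B$, $\delta(a,b)$ denotes the map $x \mapsto \{a,b,x\} - \{b,a,x\}$, here considered as a map $A\to B$. A linear map $D : A \to B$ is a generalised derivation if $D(ab) = D(a)b + aD(b) - aD(1)b$ for all $a,b \in A$; it is a derivation if $D(ab) = D(a)b + aD(b)$ for all $a,b\in A$; it is a Jordan derivation if $D(a\circ b) = D(a)\circ b + a\circ D(b)$ for all $a,b\in A$, where $x\circ y := \frac12(xy+yx)$. *)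

theory Defs
  imports "HOL-Analysis.Analysis"
begin

class complex_vector = real_vector +
  fixes scaleC :: "complex \<Rightarrow> 'a \<Rightarrow> 'a" (infixr "*\<^sub>C" 75)
  assumes scaleC_add_right: "c *\<^sub>C (x + y) = c *\<^sub>C x + c *\<^sub>C y"
    and scaleC_add_left: "(c + d) *\<^sub>C x = c *\<^sub>C x + d *\<^sub>C x"
    and scaleC_scaleC: "c *\<^sub>C (d *\<^sub>C x) = (c * d) *\<^sub>C x"
    and scaleC_one: "1 *\<^sub>C x = x"
    and scaleR_scaleC: "r *\<^sub>R x = complex_of_real r *\<^sub>C x"

class complex_normed_algebra = complex_vector + real_normed_algebra +
  assumes norm_scaleC: "norm (c *\<^sub>C x) = cmod c * norm x"
    and mult_scaleC_left: "(c *\<^sub>C x) * y = c *\<^sub>C (x * y)"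
    and mult_scaleC_right: "x * (c *\<^sub>C y) = c *\<^sub>C (x * y)"

(* The unit comes from monoid_mult rather than real_normed_algebra_1, so the zero
   algebra is not excluded; norm 1 = 1 is a consequence whenever 1 and 0 differ. *)
class unital_cstar_algebra = complex_normed_algebra + monoid_mult + banach +
  fixes adj :: "'a \<Rightarrow> 'a"
  assumes adj_add: "adj (x + y) = adj x + adj y"
    and adj_scaleC: "adj (c *\<^sub>C x) = cnj c *\<^sub>C adj x"
    and adj_mult: "adj (x * y) = adj y * adj x"
    and adj_adj: "adj (adj x) = x"
    and cstar_identity: "norm (adj x * x) = (norm x)\<^sup>2"

definition cstar_subalgebra :: "'b::unital_cstar_algebra set \<Rightarrow> bool" where
  "cstar_subalgebra A \<longleftrightarrow>
     0 \<in> A \<and> (\<forall>x\<in>A. \<forall>y\<in>A. x + y \<in> A) \<and> (\<forall>c. \<forall>x\<in>A. c *\<^sub>C x \<in> A) \<and>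
     (\<forall>x\<in>A. \<forall>y\<in>A. x * y \<in> A) \<and> (\<forall>x\<in>A. adj x \<in> A) \<and> closed A"

(* A map A -> B is represented by a function on the whole type, whose values
   outside A are irrelevant: all notions below only refer to its values on A. *)

definition clinear_on :: "'b::unital_cstar_algebra set \<Rightarrow> ('b \<Rightarrow> 'b) \<Rightarrow> bool" where
  "clinear_on A f \<longleftrightarrow>
     (\<forall>x\<in>A. \<forall>y\<in>A. f (x + y) = f x + f y) \<and> (\<forall>c. \<forall>x\<in>A. f (c *\<^sub>C x) = c *\<^sub>C f x)"

definition bounded_clinear_on :: "'b::unital_cstar_algebra set \<Rightarrow> ('b \<Rightarrow> 'b) \<Rightarrow> bool" where
  "bounded_clinear_on A f \<longleftrightarrow> clinear_on A f \<and> (\<exists>K. \<forall>x\<in>A. norm (f x) \<le> norm x * K)"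

definition triple :: "'b::unital_cstar_algebra \<Rightarrow> 'b \<Rightarrow> 'b \<Rightarrow> 'b" where
  "triple a b c = (1/2) *\<^sub>R (a * adj b * c + c * adj b * a)"

definition triple_derivation :: "'b::unital_cstar_algebra set \<Rightarrow> ('b \<Rightarrow> 'b) \<Rightarrow> bool" where
  "triple_derivation A d \<longleftrightarrow> clinear_on A d \<and>
     (\<forall>a\<in>A. \<forall>b\<in>A. \<forall>c\<in>A.
        d (triple a b c) = triple (d a) b c + triple a (d b) c + triple a b (d c))"

definition local_triple_derivation :: "'b::unital_cstar_algebra set \<Rightarrow> ('b \<Rightarrow> 'b) \<Rightarrow> bool" where
  "local_triple_derivation A T \<longleftrightarrow> bounded_clinear_on A T \<and>
     (\<forall>a\<in>A. \<exists>d. triple_derivation A d \<and> T a = d a)"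

definition inner_triple :: "'b::unital_cstar_algebra \<Rightarrow> 'b \<Rightarrow> 'b \<Rightarrow> 'b" where
  "inner_triple a b x = triple a b x - triple b a x"

definition generalised_derivation :: "'b::unital_cstar_algebra set \<Rightarrow> ('b \<Rightarrow> 'b) \<Rightarrow> bool" where
  "generalised_derivation A D \<longleftrightarrow> clinear_on A D \<and>
     (\<forall>a\<in>A. \<forall>b\<in>A. D (a * b) = D a * b + a * D b - a * D 1 * b)"

definition derivation :: "'b::unital_cstar_algebra set \<Rightarrow> ('b \<Rightarrow> 'b) \<Rightarrow> bool" where
  "derivation A D \<longleftrightarrow> clinear_on A D \<and> (\<forall>a\<in>A. \<forall>b\<in>A. D (a * b) = D a * b + a * D b)"

definition jordan_prod :: "'b::unital_cstar_algebra \<Rightarrow> 'b \<Rightarrow> 'b" where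
  "jordan_prod x y = (1/2) *\<^sub>R (x * y + y * x)"

definition jordan_derivation :: "'b::unital_cstar_algebra set \<Rightarrow> ('b \<Rightarrow> 'b) \<Rightarrow> bool" where
  "jordan_derivation A D \<longleftrightarrow> clinear_on A D \<and>
     (\<forall>a\<in>A. \<forall>b\<in>A. D (jordan_prod a b) = jordan_prod (D a) b + jordan_prod a (D b))"

end

theory Submission imports Defs begin

text \<open>
  Put \<open>h = T 1\<close>. The triple identity at the unit gives \<open>adj h = - h\<close>, and then
  \<open>inner_triple h 1 x = h * x + x * h\<close> is a triple derivation in \<open>x\<close>. So
  \<open>D x = T x - (h * x + x * h) / 2\<close> is again a local triple derivation, and \<open>D 1 = 0\<close>. If \<open>D\<close> is
  a derivation, expanding \<open>T\<close> in terms of \<open>D\<close> and \<open>h\<close> gives the generalised Leibniz rule, so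
  the whole claim is that \<open>D\<close> is a derivation. The argument uses neither Gelfand theory nor
  the bidual; unitaries do all the work.

  To see this, apply the local hypothesis to \<open>D\<close> at unitaries \<open>u\<close> of \<open>A\<close>: since
  \<open>u = {u,u,u}\<close>, it says that \<open>adj u * D u\<close> is skew-adjoint (\<open>triple_derivation_unitary\<close>). Every skew-adjoint \<open>x\<close> in
  \<open>A\<close> is tangent to a curve of unitaries, the Cayley transforms of \<open>t x\<close> (\<open>unitary_curve\<close>).
  Comparing coefficients of \<open>t\<close> and \<open>t\<^sup>2\<close> along this curve yields
  \<open>D (x\<^sup>2) = x * D x + D x * x\<close> for skew-adjoint \<open>x\<close>, hence for all \<open>x\<close> in \<open>A\<close>
  (\<open>jordan_square\<close>).

  It remains to pass from the Jordan identity to the Leibniz rule. The defect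
  \<open>f a b = D (a * b) - D a * b - a * D b\<close> is a Hochschild 2-cocycle, and on a commutative
  algebra the Jordan identity makes it antisymmetric. These two properties force \<open>f a b\<close> to
  commute with \<open>a\<close> and \<open>f (a\<^sup>n) b = n a\<^sup>n\<^sup>-\<^sup>1 f a b\<close>
  (\<open>defect_commutes\<close>, \<open>defect_power\<close>). For a unitary \<open>a\<close> the left side is bounded in \<open>n\<close>, while the
  right side has norm \<open>n * norm (f a b)\<close>; hence \<open>f a b = 0\<close>. Differentiating
  \<open>f u b = 0\<close> along the unitary curves gives \<open>f x b = 0\<close> for skew-adjoint \<open>x\<close>, and by
  linearity \<open>f = 0\<close>.
\<close>

section \<open>Scalars, adjoints and isometries\<close>

lemma scaleC_minus1: "(-1) *\<^sub>C (x::'b::unital_cstar_algebra) = - x"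
  using scaleR_scaleC[of "-1" x] by simp

lemma scaleC_minus_right: "c *\<^sub>C (- x) = - (c *\<^sub>C (x::'b::unital_cstar_algebra))"
  by (metis scaleC_minus1 scaleC_scaleC mult.commute)

lemma scaleC_minus_left: "(- c) *\<^sub>C x = - (c *\<^sub>C (x::'b::unital_cstar_algebra))"
  using scaleC_scaleC[of "-1" c x] by (simp add: scaleC_minus1)

lemma scaleC_zero_right: "c *\<^sub>C (0::'b::unital_cstar_algebra) = 0"
  using scaleC_add_right[of c "0::'b" 0] by simp

lemma scaleC_diff_right: "c *\<^sub>C (x - y) = c *\<^sub>C x - c *\<^sub>C (y::'b::unital_cstar_algebra)"
  using scaleC_add_right[of c x "- y"] by (simp add: scaleC_minus_right)

lemma scaleC_scaleR_commute:
  "c *\<^sub>C (r *\<^sub>R x) = r *\<^sub>R (c *\<^sub>C (x::'b::unital_cstar_algebra))"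
  by (simp add: scaleR_scaleC scaleC_scaleC mult.commute)

lemma adj_scaleR: "adj (r *\<^sub>R x) = r *\<^sub>R adj (x::'b::unital_cstar_algebra)"
  by (simp add: scaleR_scaleC adj_scaleC)

lemma adj_minus: "adj (- x) = - adj (x::'b::unital_cstar_algebra)"
  using adj_scaleR[of "-1" x] by simp

lemma adj_diff: "adj (x - y) = adj x - adj (y::'b::unital_cstar_algebra)"
  using adj_add[of x "- y"] by (simp add: adj_minus)

lemma adj_one: "adj 1 = (1::'b::unital_cstar_algebra)"
  by (metis adj_adj adj_mult mult_1_left mult_1_right)

lemma norm_adj: "norm (adj x) = norm (x::'b::unital_cstar_algebra)"
proof -
  have le: "norm y \<le> norm (adj y)" for y :: 'b
  proof (cases "norm y = 0")
    case False
    have "(norm y)\<^sup>2 \<le> norm (adj y) * norm y"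
      by (metis cstar_identity norm_mult_ineq)
    with False show ?thesis by (simp add: power2_eq_square)
  qed simp
  from le[of x] le[of "adj x"] show ?thesis by (simp add: adj_adj)
qed

lemma norm_isometry_mult:
  fixes u x :: "'b::unital_cstar_algebra"
  assumes "adj u * u = 1"
  shows "norm (u * x) = norm x"
proof -
  have "adj (u * x) * (u * x) = adj x * (adj u * u) * x"
    by (simp add: adj_mult mult.assoc)
  then have "(norm (u * x))\<^sup>2 = (norm x)\<^sup>2"
    using assms by (metis cstar_identity mult_1_right)
  then show ?thesis by simp
qed

lemma norm_isometry_power_mult:
  fixes u x :: "'b::unital_cstar_algebra"
  assumes "adj u * u = 1"
  shows "norm (u ^ n * x) = norm x"
  by (induction n) (simp_all add: mult.assoc norm_isometry_mult[OF assms])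

section \<open>Comparing coefficients\<close>

lemma eq_0_if_norm_le_small:
  fixes a :: "'a::real_normed_vector"
  assumes "\<epsilon> > 0" and "\<And>t. 0 < t \<Longrightarrow> t < \<epsilon> \<Longrightarrow> norm a \<le> t * C"
  shows "a = 0"
proof -
  have "((\<lambda>t. t * C) \<longlongrightarrow> 0 * C) (at_right 0)"
    by (intro tendsto_intros)
  moreover have "\<forall>\<^sub>F t in at_right 0. norm a \<le> t * C"
    using assms unfolding eventually_at_right_field by blast
  ultimately have "norm a \<le> 0 * C"
    by (intro tendsto_lowerbound) auto
  then show ?thesis by simp
qed

text \<open>Only a bound on the cubic remainder is needed to read off the first two coefficients, so the
  remainder may depend on \<open>t\<close> in any way.\<close>

lemma small_cubic_coefficients:
  fixes a b :: "'a::real_normed_vector" and c :: "real \<Rightarrow> 'a"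
  assumes "\<epsilon> > 0" "\<epsilon> \<le> 1"
    and c: "\<And>t. 0 < t \<Longrightarrow> t < \<epsilon> \<Longrightarrow> norm (c t) \<le> C"
    and eq: "\<And>t. 0 < t \<Longrightarrow> t < \<epsilon> \<Longrightarrow> t *\<^sub>R a + t^2 *\<^sub>R b + t^3 *\<^sub>R c t = 0"
  shows "a = 0" and "b = 0"
proof -
  have red: "a + t *\<^sub>R (b + t *\<^sub>R c t) = 0" if "0 < t" "t < \<epsilon>" for t
  proof -
    have "t *\<^sub>R (a + t *\<^sub>R (b + t *\<^sub>R c t)) = 0"
      using eq[OF that] by (simp add: scaleR_add_right power2_eq_square power3_eq_cube add.assoc
          mult.assoc)
    with that show ?thesis by simp
  qed
  show a: "a = 0"
  proof (rule eq_0_if_norm_le_small[OF \<open>\<epsilon> > 0\<close>])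
    fix t :: real assume t: "0 < t" "t < \<epsilon>"
    have "a = - (t *\<^sub>R (b + t *\<^sub>R c t))"
      using red[OF t] by (simp add: eq_neg_iff_add_eq_0)
    then have "norm a = t * norm (b + t *\<^sub>R c t)"
      using t by simp
    also have "norm (b + t *\<^sub>R c t) \<le> norm b + t * norm (c t)"
      using norm_triangle_ineq[of b "t *\<^sub>R c t"] t by simp
    also have "\<dots> \<le> norm b + C"
      using t \<open>\<epsilon> \<le> 1\<close> c[OF t] mult_left_le_one_le[of "norm (c t)" t] by simp
    finally show "norm a \<le> t * (norm b + C)"
      using t by (simp add: mult_left_mono)
  qed
  show "b = 0"
  proof (rule eq_0_if_norm_le_small[OF \<open>\<epsilon> > 0\<close>])
    fix t :: real assume t: "0 < t" "t < \<epsilon>"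
    have "b = - (t *\<^sub>R c t)"
      using red[OF t] a t by (simp add: eq_neg_iff_add_eq_0)
    then show "norm b \<le> t * C"
      using t c[OF t] by (simp add: mult_left_mono)
  qed
qed

section \<open>Unitaries in a commutative subalgebra\<close>

locale commutative_cstar_subalgebra =
  fixes A :: "'b::unital_cstar_algebra set"
  assumes subalgebra: "cstar_subalgebra A"
    and one_mem: "1 \<in> A"
    and commute: "a \<in> A \<Longrightarrow> b \<in> A \<Longrightarrow> a * b = b * a"
begin

lemma add_mem: "x \<in> A \<Longrightarrow> y \<in> A \<Longrightarrow> x + y \<in> A"
  and scaleC_mem: "x \<in> A \<Longrightarrow> c *\<^sub>C x \<in> A"
  and mult_mem: "x \<in> A \<Longrightarrow> y \<in> A \<Longrightarrow> x * y \<in> A"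
  and adj_mem: "x \<in> A \<Longrightarrow> adj x \<in> A"
  and zero_mem: "0 \<in> A"
  and closed_A: "closed A"
  using subalgebra by (auto simp: cstar_subalgebra_def)

lemma scaleR_mem: "x \<in> A \<Longrightarrow> r *\<^sub>R x \<in> A"
  by (simp add: scaleR_scaleC scaleC_mem)

lemma minus_mem: "x \<in> A \<Longrightarrow> - x \<in> A"
  using scaleR_mem[of x "-1"] by simp

lemma diff_mem: "x \<in> A \<Longrightarrow> y \<in> A \<Longrightarrow> x - y \<in> A"
  using add_mem[of x "- y"] minus_mem by simp

lemma power_mem: "x \<in> A \<Longrightarrow> x ^ n \<in> A"
  by (induction n) (auto intro: one_mem mult_mem)

lemma sum_mem: "(\<And>i. i \<in> I \<Longrightarrow> g i \<in> A) \<Longrightarrow> sum g I \<in> A"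
  by (induction I rule: infinite_finite_induct) (auto intro: zero_mem add_mem)

lemmas mem = add_mem scaleC_mem mult_mem adj_mem zero_mem one_mem scaleR_mem minus_mem diff_mem
  power_mem

lemma neumann_inverse:
  assumes "x \<in> A" and "norm x \<le> 1/2"
  obtains z where "z \<in> A" "z = 1 + x * z" "norm z \<le> 2 * norm (1::'b)"
proof -
  have np: "norm (x ^ n) \<le> norm (1::'b) * (1/2) ^ n" for n
  proof (induction n)
    case (Suc n)
    have "norm (x ^ Suc n) \<le> norm x * norm (x ^ n)"
      by (simp add: norm_mult_ineq)
    also have "\<dots> \<le> (1/2) * (norm (1::'b) * (1/2) ^ n)"
      using Suc assms(2) by (intro mult_mono) auto
    finally show ?case by simp
  qed simp
  have "summable (\<lambda>n. norm (1::'b) * (1/2) ^ n)"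
    by (intro summable_mult summable_geometric) simp
  then have sm: "summable (\<lambda>n. x ^ n)"
    by (rule summable_comparison_test') (use np in auto)
  define z where "z = (\<Sum>n. x ^ n)"
  have "(\<lambda>n. \<Sum>i<n. x ^ i) \<longlonglongrightarrow> z"
    unfolding z_def by (rule summable_LIMSEQ[OF sm])
  then have zA: "z \<in> A"
    by (rule closed_sequentially[OF closed_A, rotated]) (intro sum_mem power_mem assms)
  have "x * z = (\<Sum>n. x * x ^ n)"
    unfolding z_def by (rule bounded_linear.suminf[OF bounded_linear_mult_right sm])
  also have "\<dots> = z - 1"
    unfolding z_def using suminf_split_head[OF sm] by (simp only: power_Suc power_0)
  finally have z: "z = 1 + x * z"
    by (metis add_diff_cancel_left' diff_add_cancel add.commute)
  have "norm (1 + x * z) \<le> norm (1::'b) + norm x * norm z"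
    by (intro norm_triangle_mono norm_mult_ineq order_refl)
  then have "norm z \<le> norm (1::'b) + norm x * norm z"
    by (simp only: z[symmetric])
  also have "norm x * norm z \<le> (1/2) * norm z"
    by (intro mult_right_mono[OF assms(2)]) simp
  finally have "norm z \<le> 2 * norm (1::'b)"
    by linarith
  with zA z show ?thesis by (rule that)
qed

text \<open>The curve is the Cayley transform \<open>u = (1 + t x) (1 - t x)\<^sup>-\<^sup>1\<close>. With
  \<open>z = (1 - t x)\<^sup>-\<^sup>1\<close> it equals \<open>2 z - 1\<close>, so three substitutions of
  \<open>z = 1 + t x z\<close> produce the expansion with remainder \<open>2 x\<^sup>3 z\<close>.\<close>

lemma unitary_curve:
  assumes x: "x \<in> A" and skew: "adj x = - x"
  obtains \<epsilon> C :: real and r :: "real \<Rightarrow> 'b" where "0 < \<epsilon>" "\<epsilon> \<le> 1"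
    "\<And>t. 0 < t \<Longrightarrow> t < \<epsilon> \<Longrightarrow> r t \<in> A \<and> norm (r t) \<le> C \<and>
       (\<exists>u\<in>A. adj u * u = 1 \<and> u = 1 + (2 * t) *\<^sub>R x + (2 * t^2) *\<^sub>R (x * x) + t^3 *\<^sub>R r t)"
proof -
  define \<epsilon> where "\<epsilon> = 1 / (2 * (norm x + 1))"
  have eps: "0 < \<epsilon>" "\<epsilon> \<le> 1"
    using norm_ge_zero[of x] by (simp_all add: \<epsilon>_def divide_simps, linarith+)
  define C where "C = 2 * (norm (x * x * x) * (2 * norm (1::'b)))"
  have ex: "\<exists>r. r \<in> A \<and> norm r \<le> C \<and> (\<exists>u\<in>A. adj u * u = 1 \<and>
      u = 1 + (2 * t) *\<^sub>R x + (2 * t^2) *\<^sub>R (x * x) + t^3 *\<^sub>R r)"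
    if t: "0 < t" "t < \<epsilon>" for t
  proof -
    have "t * norm x \<le> \<epsilon> * (norm x + 1)"
      using t by (intro mult_mono) auto
    also have "\<dots> = 1/2"
      using norm_ge_zero[of x] by (simp add: \<epsilon>_def divide_simps add_nonneg_eq_0_iff)
    finally have "norm (t *\<^sub>R x) \<le> 1/2" using t by simp
    then obtain z where z: "z \<in> A" "z = 1 + t *\<^sub>R x * z" "norm z \<le> 2 * norm (1::'b)"
      using neumann_inverse[of "t *\<^sub>R x"] scaleR_mem[OF x] by blast
    define y where "y = t *\<^sub>R x"
    have y: "y \<in> A" "adj y = - y"
      using x skew by (simp_all add: y_def adj_scaleR scaleR_mem)
    have zy: "z = 1 + y * z"
      using z(2) unfolding y_def .
    define u where "u = (1 + y) * z"
    have "z - y * z = 1"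
      using zy by (metis add_diff_cancel_right')
    then have inv: "(1 - y) * z = 1"
      by (simp add: left_diff_distrib)
    have adj_inv: "adj z * (1 + y) = 1"
      using arg_cong[OF inv, of adj] by (simp add: adj_mult adj_diff adj_one y)
    have "adj u * u = adj z * ((1 - y) * (1 + y)) * z"
      by (simp add: u_def adj_mult adj_add adj_one y mult.assoc)
    also have "(1 - y) * (1 + y) = (1 + y) * (1 - y)"
      by (simp add: algebra_simps)
    also have "adj z * ((1 + y) * (1 - y)) * z = (adj z * (1 + y)) * ((1 - y) * z)"
      by (simp add: mult.assoc)
    finally have unit: "adj u * u = 1"
      by (simp add: adj_inv inv)
    define r where "r = 2 *\<^sub>R (x * x * x * z)"
    have "u = z + y * z"
      by (simp add: u_def distrib_right)
    also have "\<dots> = 1 + 2 *\<^sub>R (y * z)"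
      by (subst (1) zy) (simp add: scaleR_2 add.assoc)
    also have "y * z = y * (1 + y * (1 + y * z))"
      by (simp only: zy[symmetric])
    also have "\<dots> = y + y * y + y * y * y * z"
      by (simp add: distrib_left mult.assoc)
    finally have "u = 1 + 2 *\<^sub>R (y + y * y + y * y * y * z)" .
    then have expand: "u = 1 + (2 * t) *\<^sub>R x + (2 * t^2) *\<^sub>R (x * x) + t^3 *\<^sub>R r"
      by (simp add: y_def r_def scaleR_add_right power2_eq_square power3_eq_cube algebra_simps)
    have "norm r \<le> 2 * (norm (x * x * x) * norm z)"
      unfolding r_def by (simp add: norm_mult_ineq)
    also have "\<dots> \<le> C"
      unfolding C_def by (intro mult_left_mono z) auto
    finally have "norm r \<le> C" .
    moreover have "r \<in> A" "u \<in> A"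
      unfolding r_def u_def by (auto intro!: mem x y z)
    ultimately show ?thesis
      using unit expand by blast
  qed
  then have "\<forall>t. \<exists>r. 0 < t \<longrightarrow> t < \<epsilon> \<longrightarrow> r \<in> A \<and> norm r \<le> C \<and> (\<exists>u\<in>A. adj u * u = 1 \<and>
      u = 1 + (2 * t) *\<^sub>R x + (2 * t^2) *\<^sub>R (x * x) + t^3 *\<^sub>R r)"
    by blast
  from choice[OF this] obtain r where r:
    "\<forall>t. 0 < t \<longrightarrow> t < \<epsilon> \<longrightarrow> r t \<in> A \<and> norm (r t) \<le> C \<and> (\<exists>u\<in>A. adj u * u = 1 \<and>
      u = 1 + (2 * t) *\<^sub>R x + (2 * t^2) *\<^sub>R (x * x) + t^3 *\<^sub>R r t)" ..
  show ?thesis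
    by (rule that[OF eps, of r C], rule r[rule_format])
qed

lemma skew_decomposition:
  assumes "a \<in> A"
  obtains x y where "x \<in> A" "y \<in> A" "adj x = - x" "adj y = - y" "a = x + \<i> *\<^sub>C y"
proof
  define x where "x = (1/2) *\<^sub>R (a - adj a)"
  define y where "y = (-\<i>) *\<^sub>C ((1/2) *\<^sub>R (a + adj a))"
  show "x \<in> A" "y \<in> A"
    unfolding x_def y_def by (auto intro!: mem assms)
  show "adj x = - x"
    by (simp add: x_def adj_scaleR adj_diff adj_adj flip: scaleR_minus_right)
  show "adj y = - y"
    by (simp add: y_def adj_scaleC adj_scaleR adj_add adj_adj add.commute scaleC_scaleC
        flip: scaleC_minus1)
  have "x + \<i> *\<^sub>C y = x + (1/2) *\<^sub>R (a + adj a)"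
    by (simp add: y_def scaleC_scaleC scaleC_one)
  also have "\<dots> = a"
    by (simp add: x_def scaleR_add_right scaleR_diff_right flip: scaleR_add_left)
  finally show "a = x + \<i> *\<^sub>C y" by simp
qed

end

section \<open>Linear maps and triple derivations\<close>

locale bounded_map_on_subalgebra = commutative_cstar_subalgebra A
  for A :: "'b::unital_cstar_algebra set" +
  fixes D :: "'b \<Rightarrow> 'b"
  assumes bounded_clinear: "bounded_clinear_on A D"
begin

lemma D_add: "a \<in> A \<Longrightarrow> b \<in> A \<Longrightarrow> D (a + b) = D a + D b"
  and D_scaleC: "a \<in> A \<Longrightarrow> D (c *\<^sub>C a) = c *\<^sub>C D a"
  using bounded_clinear by (auto simp: bounded_clinear_on_def clinear_on_def)

lemma D_scaleR: "a \<in> A \<Longrightarrow> D (r *\<^sub>R a) = r *\<^sub>R D a"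
  by (simp add: scaleR_scaleC D_scaleC)

lemma D_bound: obtains K where "K \<ge> 0" "\<And>a. a \<in> A \<Longrightarrow> norm (D a) \<le> K * norm a"
proof -
  obtain K where K: "\<And>a. a \<in> A \<Longrightarrow> norm (D a) \<le> norm a * K"
    using bounded_clinear by (auto simp: bounded_clinear_on_def)
  have "norm (D a) \<le> \<bar>K\<bar> * norm a" if "a \<in> A" for a
    using K[OF that] mult_left_mono[OF abs_ge_self[of K] norm_ge_zero[of a]]
    by (simp add: mult.commute)
  then show ?thesis using that[of "\<bar>K\<bar>"] by simp
qed

end

text \<open>Evaluate the triple identity at \<open>u = {u,u,u}\<close>. At \<open>u = 1\<close> this says that \<open>d 1\<close> is skew-adjoint.\<close>

lemma triple_derivation_unitary:
  assumes d: "triple_derivation A d" and u: "u \<in> A" "adj u * u = 1" "u * adj u = 1"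
  shows "adj u * d u + adj (d u) * u = 0"
proof -
  have uuu: "triple u u u = u"
    using u by (simp add: triple_def flip: scaleR_add_left)
  have "d u = triple (d u) u u + triple u (d u) u + triple u u (d u)"
    using d u(1) uuu unfolding triple_derivation_def by metis
  also have "triple (d u) u u = d u"
    using u by (simp add: triple_def mult.assoc flip: scaleR_add_left)
  also have "triple u u (d u) = d u"
    using u by (simp add: triple_def mult.assoc flip: scaleR_add_left)
  also have "triple u (d u) u = u * adj (d u) * u"
    by (simp add: triple_def flip: scaleR_add_left)
  finally have "d u + u * adj (d u) * u = 0"
    by (simp add: algebra_simps)
  then have "adj u * (d u + u * adj (d u) * u) = 0"
    by simp
  moreover have "adj u * (u * (adj (d u) * u)) = adj (d u) * u"
    using u by (simp flip: mult.assoc)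
  ultimately show ?thesis
    by (simp add: distrib_left mult.assoc)
qed

lemma inner_triple_skew:
  assumes "adj h = - h"
  shows "inner_triple h 1 x = h * x + x * h"
proof -
  have "h * x + x * h - (- (h * x) - x * h) = 2 *\<^sub>R (h * x + x * h)"
    by (simp add: scaleR_2)
  then show ?thesis
    by (simp add: inner_triple_def triple_def assms adj_one flip: scaleR_diff_right)
qed

lemma triple_derivation_anticommutator:
  assumes "adj h = - h"
  shows "triple_derivation A (\<lambda>x. h * x + x * h)"
proof -
  have add: "h * (x + y) + (x + y) * h = (h * x + x * h) + (h * y + y * h)" for x y
    by (simp add: algebra_simps)
  have scale: "h * (c *\<^sub>C x) + (c *\<^sub>C x) * h = c *\<^sub>C (h * x + x * h)" for c x
    by (simp add: mult_scaleC_left mult_scaleC_right scaleC_add_right)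
  \<comment> \<open>The middle slot contributes \<open>- (adj b * h + h * adj b)\<close>, which cancels the inner
    occurrences of \<open>h\<close> and leaves only the outer ones.\<close>
  have trip: "h * triple a b c + triple a b c * h = triple (h * a + a * h) b c +
      triple a (h * b + b * h) c + triple a b (h * c + c * h)" for a b c
    by (simp add: triple_def adj_add adj_mult assms flip: scaleR_add_right)
       (simp add: algebra_simps)
  show ?thesis
    unfolding triple_derivation_def clinear_on_def using add scale trip by simp
qed

lemma clinear_on_diff_scaleR:
  assumes "clinear_on A f" "clinear_on A g"
  shows "clinear_on A (\<lambda>x. f x - r *\<^sub>R g x)"
  using assms
  by (simp add: clinear_on_def scaleR_add_right scaleC_diff_right scaleC_scaleR_commute)

lemma triple_derivation_diff_scaleR:
  assumes "triple_derivation A d" "triple_derivation A e"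
  shows "triple_derivation A (\<lambda>x. d x - r *\<^sub>R e x)"
proof -
  have trip: "triple (p - r *\<^sub>R p') b c + triple a (q - r *\<^sub>R q') c + triple a b (s - r *\<^sub>R s')
    = (triple p b c + triple a q c + triple a b s) -
      r *\<^sub>R (triple p' b c + triple a q' c + triple a b s')" for p p' q q' s s' a b c :: 'a
    by (simp add: triple_def adj_diff adj_scaleR algebra_simps)
  show ?thesis
    using assms unfolding triple_derivation_def trip by (simp add: clinear_on_diff_scaleR)
qed

section \<open>Local triple derivations vanishing at the unit are Jordan derivations\<close>

locale normalised_local_triple_derivation = bounded_map_on_subalgebra A D
  for A :: "'b::unital_cstar_algebra set" and D :: "'b \<Rightarrow> 'b" +
  assumes local_derivation: "local_triple_derivation A D"
    and D_one: "D 1 = 0"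
begin

lemma unitary_skew:
  assumes "u \<in> A" "adj u * u = 1"
  shows "adj u * D u + adj (D u) * u = 0"
proof -
  obtain d where d: "triple_derivation A d" "D u = d u"
    using local_derivation assms(1) unfolding local_triple_derivation_def by blast
  have "u * adj u = 1"
    using assms commute adj_mem by metis
  with triple_derivation_unitary[OF d(1) assms] show ?thesis
    by (simp add: d(2))
qed

text \<open>With \<open>S w = w + adj w\<close>, the previous lemma says \<open>S (adj u * D u) = 0\<close>. Along
  the unitary curve through \<open>x\<close>, and because \<open>D 1 = 0\<close>, the coefficient of \<open>t\<close> in it is
  \<open>2 S (D x)\<close> and that of \<open>t\<^sup>2\<close> is \<open>2 S (D (x\<^sup>2)) - 4 S (x * D x)\<close>.\<close>

lemma skew_coefficients:
  assumes x: "x \<in> A" and skew: "adj x = - x"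
  shows "adj (D x) = - D x"
    and "D (x * x) + adj (D (x * x)) = 2 *\<^sub>R (x * D x + D x * x)"
proof -
  define S :: "'b \<Rightarrow> 'b" where "S w = w + adj w" for w
  have S_add: "S (v + w) = S v + S w" and S_scaleR: "S (s *\<^sub>R w) = s *\<^sub>R S w"
    and S_diff: "S (v - w) = S v - S w" and S_norm: "norm (S w) \<le> 2 * norm w" for v w s
    using norm_triangle_ineq[of w "adj w"]
    by (simp_all add: S_def adj_add adj_scaleR adj_diff algebra_simps norm_adj)
  obtain \<epsilon> C r where eps: "0 < \<epsilon>" "\<epsilon> \<le> 1"
    and curve: "\<And>t. 0 < t \<Longrightarrow> t < \<epsilon> \<Longrightarrow> r t \<in> A \<and> norm (r t) \<le> C \<and> (\<exists>u\<in>A. adj u * u = 1 \<and>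
       u = 1 + (2 * t) *\<^sub>R x + (2 * t^2) *\<^sub>R (x * x) + t^3 *\<^sub>R r t)"
    by (rule unitary_curve[OF x skew]) (rule that)
  obtain K where K: "K \<ge> 0" "\<And>a. a \<in> A \<Longrightarrow> norm (D a) \<le> K * norm a"
    using D_bound by blast
  define p where "p = 2 *\<^sub>R D x"
  define q where "q = 2 *\<^sub>R D (x * x) - 4 *\<^sub>R (x * D x)"
  \<comment> \<open>\<open>adj u = 1 - 2 t x + t\<^sup>2 R\<close> and \<open>D u = 2 t D x + t\<^sup>2 Q\<close>; then \<open>w\<close> is the
    remainder of order \<open>t\<^sup>3\<close> of their product.\<close>
  define R where "R t = 2 *\<^sub>R (x * x) + t *\<^sub>R adj (r t)" for t
  define Q where "Q t = 2 *\<^sub>R D (x * x) + t *\<^sub>R D (r t)" for t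
  define w where "w t = D (r t) - 2 *\<^sub>R (x * Q t) + R t * (2 *\<^sub>R D x + t *\<^sub>R Q t)" for t
  have eq: "t *\<^sub>R S p + t^2 *\<^sub>R S q + t^3 *\<^sub>R S (w t) = 0" if t: "0 < t" "t < \<epsilon>" for t
  proof -
    from curve[OF t] obtain u where u: "u \<in> A" "adj u * u = 1"
      "u = 1 + (2 * t) *\<^sub>R x + (2 * t^2) *\<^sub>R (x * x) + t^3 *\<^sub>R r t" and r: "r t \<in> A"
      by blast
    have Du: "D u = (2 * t) *\<^sub>R D x + t^2 *\<^sub>R Q t"
      unfolding u(3) Q_def
      by (simp add: D_add D_scaleR D_one mem x r scaleR_add_right power2_eq_square
          power3_eq_cube mult.assoc mult.left_commute)
    have adju: "adj u = 1 - (2 * t) *\<^sub>R x + t^2 *\<^sub>R R t"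
      unfolding u(3) R_def
      by (simp add: adj_add adj_scaleR adj_mult adj_one skew scaleR_add_right power2_eq_square
          power3_eq_cube mult.assoc mult.left_commute)
    have prod: "adj u * D u = D u - (2 * t) *\<^sub>R (x * D u) + t^2 *\<^sub>R (R t * D u)"
      unfolding adju by (simp add: distrib_right left_diff_distrib)
    have xDu: "x * D u = (2 * t) *\<^sub>R (x * D x) + t^2 *\<^sub>R (x * Q t)"
      unfolding Du by (simp add: distrib_left)
    have RDu: "R t * D u = t *\<^sub>R (R t * (2 *\<^sub>R D x + t *\<^sub>R Q t))"
      unfolding Du by (simp add: distrib_left scaleR_add_right power2_eq_square mult.commute)
    have "adj u * D u = t *\<^sub>R p + t^2 *\<^sub>R q + t^3 *\<^sub>R w t"
      unfolding prod unfolding xDu RDu unfolding Du p_def q_def w_def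
      by (simp add: Q_def algebra_simps power2_eq_square power3_eq_cube)
    moreover have "S (adj u * D u) = 0"
      using unitary_skew[OF u(1,2)] by (simp add: S_def adj_mult adj_adj)
    ultimately show ?thesis by (simp add: S_add S_scaleR)
  qed
  define q' where "q' = 2 * norm (D (x * x)) + K * C"
  define M where "M = K * C + 2 * (norm x * q') + (2 * norm (x * x) + C) * (2 * norm (D x) + q')"
  have bound: "norm (S (w t)) \<le> 2 * M" if t: "0 < t" "t < \<epsilon>" for t
  proof -
    have shrink: "norm (t *\<^sub>R v) \<le> k" if "norm v \<le> k" for v :: 'b and k
      using that t eps mult_left_le_one_le[of "norm v" t] by simp
    have r: "r t \<in> A" "norm (r t) \<le> C"
      using curve[OF t] by blast+
    have Dr: "norm (D (r t)) \<le> K * C"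
      using K(2)[OF r(1)] mult_left_mono[OF r(2) K(1)] by linarith
    have Q: "norm (Q t) \<le> q'"
      unfolding Q_def q'_def by (rule norm_triangle_mono[OF _ shrink[OF Dr]]) simp
    have "norm (adj (r t)) \<le> C"
      using r(2) by (simp add: norm_adj)
    then have R: "norm (R t) \<le> 2 * norm (x * x) + C"
      unfolding R_def by (intro norm_triangle_mono[OF _ shrink]) simp
    have "norm (2 *\<^sub>R D x + t *\<^sub>R Q t) \<le> 2 * norm (D x) + q'"
      by (rule norm_triangle_mono[OF _ shrink[OF Q]]) simp
    then have "norm (R t * (2 *\<^sub>R D x + t *\<^sub>R Q t)) \<le> (2 * norm (x * x) + C) * (2 * norm (D x) + q')"
      using R by (intro order_trans[OF norm_mult_ineq] mult_mono order_trans[OF norm_ge_zero R]) auto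
    moreover have "norm (2 *\<^sub>R (x * Q t)) \<le> 2 * (norm x * q')"
      using norm_mult_ineq[of x "Q t"] mult_left_mono[OF Q norm_ge_zero[of x]] by simp
    ultimately have "norm (w t) \<le> M"
      unfolding w_def M_def
      using norm_triangle_ineq4[of "D (r t)" "2 *\<^sub>R (x * Q t)"] Dr
      by (intro norm_triangle_mono) linarith+
    with S_norm[of "w t"] show ?thesis by simp
  qed
  have S: "S p = 0" "S q = 0"
    using small_cubic_coefficients[of \<epsilon> "\<lambda>t. S (w t)" "2 * M" "S p" "S q"] eps bound eq by blast+
  have "2 *\<^sub>R S (D x) = 0"
    using S(1) by (simp add: p_def S_scaleR)
  then have "S (D x) = 0" by simp
  then show Dx: "adj (D x) = - D x"
    by (simp add: S_def eq_neg_iff_add_eq_0 add.commute)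
  have "2 *\<^sub>R S (D (x * x)) = 2 *\<^sub>R (2 *\<^sub>R S (x * D x))"
    using S(2) by (simp add: q_def S_scaleR S_diff)
  then have "S (D (x * x)) = 2 *\<^sub>R S (x * D x)" by (simp only: scaleR_cancel_left) simp
  then show "D (x * x) + adj (D (x * x)) = 2 *\<^sub>R (x * D x + D x * x)"
    by (simp add: S_def adj_mult skew Dx)
qed

lemma jordan_square_skew:
  assumes x: "x \<in> A" and skew: "adj x = - x"
  shows "D (x * x) = x * D x + D x * x"
proof -
  \<comment> \<open>\<open>x * x\<close> is self-adjoint, so \<open>\<i> *\<^sub>C (x * x)\<close> is skew and \<open>D (x * x)\<close> is self-adjoint.\<close>
  have "adj (D (\<i> *\<^sub>C (x * x))) = - D (\<i> *\<^sub>C (x * x))"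
    by (rule skew_coefficients) (simp_all add: mem x adj_scaleC adj_mult skew scaleC_minus_left)
  then have "\<i> *\<^sub>C adj (D (x * x)) = \<i> *\<^sub>C D (x * x)"
    by (simp add: D_scaleC mem x adj_scaleC scaleC_minus_left)
  then have "(-\<i>) *\<^sub>C (\<i> *\<^sub>C adj (D (x * x))) = (-\<i>) *\<^sub>C (\<i> *\<^sub>C D (x * x))"
    by simp
  then have "adj (D (x * x)) = D (x * x)"
    by (simp add: scaleC_scaleC scaleC_one)
  with skew_coefficients(2)[OF x skew] have "2 *\<^sub>R D (x * x) = 2 *\<^sub>R (x * D x + D x * x)"
    by (simp add: scaleR_2)
  then show ?thesis by (simp only: scaleR_cancel_left) simp
qed

lemma jordan_skew:
  assumes x: "x \<in> A" "adj x = - x" and y: "y \<in> A" "adj y = - y"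
  shows "2 *\<^sub>R D (x * y) = x * D y + D y * x + y * D x + D x * y"
proof -
  have "D ((x + y) * (x + y)) = (x + y) * D (x + y) + D (x + y) * (x + y)"
    by (rule jordan_square_skew) (auto intro: mem x y simp: adj_add x y)
  moreover have "(x + y) * (x + y) = x * x + (2 *\<^sub>R (x * y) + y * y)"
    using commute[OF x(1) y(1)] by (simp add: distrib_left distrib_right scaleR_2 add.assoc)
  ultimately have "D (x * x) + (2 *\<^sub>R D (x * y) + D (y * y))
      = (x + y) * (D x + D y) + (D x + D y) * (x + y)"
    by (simp only: D_add D_scaleR mem x y)
  then show ?thesis
    by (simp add: x y jordan_square_skew algebra_simps)
qed

lemma jordan_square:
  assumes "a \<in> A"
  shows "D (a * a) = a * D a + D a * a"
proof -
  obtain x y where xy: "x \<in> A" "y \<in> A" "adj x = - x" "adj y = - y" and a: "a = x + \<i> *\<^sub>C y"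
    using skew_decomposition[OF assms] by blast
  have "a * a = x * x + (\<i> *\<^sub>C (2 *\<^sub>R (x * y)) + (-1) *\<^sub>C (y * y))"
    unfolding a using commute[OF xy(1,2)]
    by (simp add: algebra_simps mult_scaleC_left mult_scaleC_right scaleC_scaleC
        scaleC_add_right scaleR_2)
  then have "D (a * a) = D (x * x) + (\<i> *\<^sub>C (2 *\<^sub>R D (x * y)) + (-1) *\<^sub>C D (y * y))"
    by (simp only: D_add D_scaleC D_scaleR mem xy)
  also have "\<dots> = a * D a + D a * a"
    unfolding a
    by (simp add: jordan_skew jordan_square_skew xy D_add D_scaleC mem algebra_simps
        mult_scaleC_left mult_scaleC_right scaleC_scaleC scaleC_add_right scaleC_minus1)
  finally show ?thesis .
qed

section \<open>The Leibniz defect vanishes\<close>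

definition defect :: "'b \<Rightarrow> 'b \<Rightarrow> 'b" where
  "defect a b = D (a * b) - D a * b - a * D b"

lemma defect_cocycle:
  "a * defect b c - defect (a * b) c + defect a (b * c) - defect a b * c = 0"
  by (simp add: defect_def algebra_simps)

lemma defect_add_left:
  "a \<in> A \<Longrightarrow> a' \<in> A \<Longrightarrow> b \<in> A \<Longrightarrow> defect (a + a') b = defect a b + defect a' b"
  by (simp add: defect_def distrib_right D_add mem algebra_simps)

lemma defect_scaleC_left: "a \<in> A \<Longrightarrow> b \<in> A \<Longrightarrow> defect (c *\<^sub>C a) b = c *\<^sub>C defect a b"
  by (simp add: defect_def mult_scaleC_left D_scaleC mem scaleC_diff_right)

lemma defect_scaleR_left: "a \<in> A \<Longrightarrow> b \<in> A \<Longrightarrow> defect (r *\<^sub>R a) b = r *\<^sub>R defect a b"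
  by (simp add: scaleR_scaleC defect_scaleC_left)

lemma defect_one_left: "defect 1 b = 0" and defect_one_right: "defect a 1 = 0"
  by (simp_all add: defect_def D_one)

text \<open>Because \<open>a * b = b * a\<close>, the polarised Jordan identity evaluates \<open>2 D (a * b)\<close> as the sum
  of the Leibniz expressions for \<open>a * b\<close> and for \<open>b * a\<close>, so the two defects cancel.\<close>

lemma defect_antisym:
  assumes "a \<in> A" "b \<in> A"
  shows "defect b a = - defect a b"
proof -
  have "D ((a + b) * (a + b)) = (a + b) * D (a + b) + D (a + b) * (a + b)"
    by (rule jordan_square) (intro mem assms)
  moreover have "(a + b) * (a + b) = a * a + (a * b + (a * b + b * b))"
    using commute[OF assms] by (simp add: algebra_simps)
  ultimately have "D (a * b) + D (a * b) = a * D b + D b * a + b * D a + D a * b"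
    by (simp add: D_add mem assms jordan_square algebra_simps)
  then show ?thesis
    using commute[OF assms] by (simp add: defect_def algebra_simps)
qed

lemma defect_self: "a \<in> A \<Longrightarrow> defect a a = 0"
  by (simp add: defect_def jordan_square)

text \<open>The cocycle identity at \<open>(a, a, b)\<close> and at \<open>(b, a, a)\<close> expresses
  \<open>defect (a * a) b\<close> in two ways, with \<open>defect a b\<close> multiplied by \<open>a\<close> from different sides.\<close>

lemma defect_commutes:
  assumes "a \<in> A" "b \<in> A"
  shows "a * defect a b = defect a b * a"
proof -
  have "a * defect a b + defect a (a * b) = defect (a * a) b"
    using defect_cocycle[of a a b] assms by (simp add: defect_self algebra_simps)
  moreover have "defect a b * a + defect a (a * b) = defect (a * a) b"
    using defect_cocycle[of b a a] assms commute[OF assms]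
      defect_antisym[of a "a * b"] defect_antisym[of "a * a" b] defect_antisym[OF assms]
    by (simp add: defect_self mem algebra_simps)
  ultimately show ?thesis
    by (metis add_right_cancel)
qed

lemma defect_mult_same:
  assumes "a \<in> A" "b \<in> A"
  shows "defect a (a * b) = a * defect a b"
proof -
  have "2 *\<^sub>R defect a (a * b) = a * defect a b + defect a b * a"
    using defect_cocycle[of a b a] commute[OF assms] defect_antisym[of a "a * b"]
      defect_antisym[OF assms] assms by (simp add: mem scaleR_2 algebra_simps)
  then have "2 *\<^sub>R defect a (a * b) = 2 *\<^sub>R (a * defect a b)"
    using defect_commutes[OF assms] by (simp add: scaleR_2)
  then show ?thesis by (simp only: scaleR_cancel_left) simp
qed

lemma defect_power_mult:
  assumes "a \<in> A" "b \<in> A"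
  shows "defect a (a ^ n * b) = a ^ n * defect a b"
  by (induction n) (simp_all add: mult.assoc defect_mult_same mem assms)

lemma defect_power:
  assumes "a \<in> A" "b \<in> A"
  shows "defect (a ^ Suc n) b = of_nat (Suc n) *\<^sub>R (a ^ n * defect a b)"
proof (induction n)
  case (Suc n)
  have "defect a (a ^ Suc n) = 0"
    using defect_power_mult[OF assms(1) one_mem, of "Suc n"] by (simp add: defect_one_right)
  then have "defect (a ^ Suc (Suc n)) b
      = a * defect (a ^ Suc n) b + defect a (a ^ Suc n * b)"
    using defect_cocycle[of a "a ^ Suc n" b] by (simp add: algebra_simps)
  also have "\<dots> = of_nat (Suc (Suc n)) *\<^sub>R (a ^ Suc n * defect a b)"
    unfolding Suc defect_power_mult[OF assms]
    by (simp add: mult.assoc scaleR_add_left distrib_left scaleR_2)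
  finally show ?case .
qed simp

lemma defect_bound:
  assumes "b \<in> A"
  obtains K where "K \<ge> 0" "\<And>a. a \<in> A \<Longrightarrow> norm (defect a b) \<le> K * norm a"
proof -
  obtain K where K: "K \<ge> 0" "\<And>a. a \<in> A \<Longrightarrow> norm (D a) \<le> K * norm a"
    using D_bound by blast
  have "norm (defect a b) \<le> (K * norm b + K * norm b + norm (D b)) * norm a" if a: "a \<in> A" for a
  proof -
    have "norm (D (a * b)) \<le> K * (norm a * norm b)"
      using K(2)[OF mult_mem[OF a assms]] mult_left_mono[OF norm_mult_ineq K(1), of a b] by linarith
    moreover have "norm (D a * b) \<le> K * norm a * norm b"
      using norm_mult_ineq[of "D a" b] mult_right_mono[OF K(2)[OF a], of "norm b"] by simp
    moreover have "norm (a * D b) \<le> norm a * norm (D b)"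
      by (rule norm_mult_ineq)
    moreover have "norm (defect a b) \<le> norm (D (a * b)) + norm (D a * b) + norm (a * D b)"
      unfolding defect_def by (meson norm_triangle_ineq4 order_trans add_right_mono)
    ultimately show ?thesis by (simp add: algebra_simps)
  qed
  then show ?thesis
    using that[of "K * norm b + K * norm b + norm (D b)"] K(1) by simp
qed

text \<open>The powers of a unitary are bounded, whereas \<open>defect (u ^ n) b\<close> grows linearly in \<open>n\<close> unless
  \<open>defect u b = 0\<close>.\<close>

lemma defect_unitary:
  assumes u: "u \<in> A" "adj u * u = 1" and b: "b \<in> A"
  shows "defect u b = 0"
proof (rule ccontr)
  assume nz: "defect u b \<noteq> 0"
  obtain K where K: "\<And>a. a \<in> A \<Longrightarrow> norm (defect a b) \<le> K * norm a"
    using defect_bound[OF b] by blast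
  have le: "of_nat (Suc n) * norm (defect u b) \<le> K * norm (1::'b)" for n
    using K[OF power_mem[OF u(1)], of "Suc n"] norm_isometry_power_mult[OF u(2), of "Suc n" 1]
    by (simp add: defect_power[OF u(1) b] norm_isometry_power_mult[OF u(2)] del: power_Suc)
  obtain n where "K * norm (1::'b) < of_nat n * norm (defect u b)"
    using reals_Archimedean3[of "norm (defect u b)"] nz by auto
  then have "K * norm (1::'b) < of_nat (Suc n) * norm (defect u b)"
    using mult_right_mono[of "real n" "real (Suc n)" "norm (defect u b)"] by simp
  with le[of n] show False by simp
qed

lemma defect_eq_0:
  assumes a: "a \<in> A" and b: "b \<in> A"
  shows "defect a b = 0"
proof -
  have skew: "defect x b = 0" if x: "x \<in> A" "adj x = - x" for x
  proof -
    obtain \<epsilon> C r where eps: "0 < \<epsilon>" "\<epsilon> \<le> 1"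
      and curve: "\<And>t. 0 < t \<Longrightarrow> t < \<epsilon> \<Longrightarrow> r t \<in> A \<and> norm (r t) \<le> C \<and> (\<exists>u\<in>A. adj u * u = 1 \<and>
         u = 1 + (2 * t) *\<^sub>R x + (2 * t^2) *\<^sub>R (x * x) + t^3 *\<^sub>R r t)"
      by (rule unitary_curve[OF x]) (rule that)
    obtain K where K: "K \<ge> 0" "\<And>a. a \<in> A \<Longrightarrow> norm (defect a b) \<le> K * norm a"
      using defect_bound[OF b] by blast
    have "2 *\<^sub>R defect x b = 0"
    proof (rule small_cubic_coefficients(1)[OF eps])
      fix t :: real assume t: "0 < t" "t < \<epsilon>"
      have r: "r t \<in> A" "norm (r t) \<le> C" using curve[OF t] by blast+
      show "norm (defect (r t) b) \<le> K * C"
        using K(2)[OF r(1)] mult_left_mono[OF r(2) K(1)] by linarith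
      obtain u where u: "u \<in> A" "adj u * u = 1"
        "u = 1 + (2 * t) *\<^sub>R x + (2 * t^2) *\<^sub>R (x * x) + t^3 *\<^sub>R r t"
        using curve[OF t] by blast
      have "defect u b = 0" by (rule defect_unitary[OF u(1,2) b])
      then show "t *\<^sub>R (2 *\<^sub>R defect x b) + t^2 *\<^sub>R (2 *\<^sub>R defect (x * x) b)
          + t^3 *\<^sub>R defect (r t) b = 0"
        unfolding u(3)
        by (simp add: defect_add_left defect_scaleR_left defect_one_left mem x r b mult.commute)
    qed
    then show ?thesis by simp
  qed
  obtain x y where xy: "x \<in> A" "y \<in> A" "adj x = - x" "adj y = - y" and ax: "a = x + \<i> *\<^sub>C y"
    using skew_decomposition[OF a] by blast
  have "defect a b = defect x b + \<i> *\<^sub>C defect y b"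
    unfolding ax by (simp add: defect_add_left defect_scaleC_left mem xy b)
  also have "\<dots> = 0"
    using skew xy by (simp add: scaleC_zero_right)
  finally show ?thesis .
qed

lemma derivation_D: "derivation A D"
  using bounded_clinear defect_eq_0
  by (simp add: derivation_def bounded_clinear_on_def defect_def algebra_simps)

end

lemma derivation_imp_jordan_derivation:
  assumes "cstar_subalgebra A" "derivation A D"
  shows "jordan_derivation A D"
proof -
  have lin: "D (x + y) = D x + D y" "D (r *\<^sub>R x) = r *\<^sub>R D x" "D (x * y) = D x * y + x * D y"
    if "x \<in> A" "y \<in> A" for x y r
    using that assms(2) by (simp_all add: derivation_def clinear_on_def scaleR_scaleC)
  have mem: "x * y \<in> A" "x + y \<in> A" if "x \<in> A" "y \<in> A" for x y
    using that assms(1) by (auto simp: cstar_subalgebra_def)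
  have "D (jordan_prod a b) = jordan_prod (D a) b + jordan_prod a (D b)" if "a \<in> A" "b \<in> A" for a b
    using that lin(2)[of "a * b + b * a" 0] assms(1)
    by (simp add: jordan_prod_def lin mem cstar_subalgebra_def algebra_simps)
  then show ?thesis
    using assms(2) by (simp add: jordan_derivation_def derivation_def)
qed

section \<open>Normalising at the unit\<close>

theorem corollary7:
  fixes A :: "'b::unital_cstar_algebra set" and T :: "'b \<Rightarrow> 'b"
  assumes "cstar_subalgebra A"
    and "1 \<in> A"
    and "\<forall>a\<in>A. \<forall>b\<in>A. a * b = b * a"
    and "local_triple_derivation A T"
  shows "generalised_derivation A T \<and>
    (let T' = (\<lambda>x. T x - (1/2) *\<^sub>R inner_triple (T 1) 1 x) in
       (\<forall>x\<in>A. T' x = T x - inner_triple ((1/2) *\<^sub>R T 1) 1 x) \<and>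
       local_triple_derivation A T' \<and>
       T' 1 = 0 \<and>
       derivation A T' \<and>
       jordan_derivation A T')"
proof -
  define h where "h = T 1"
  obtain d where d: "triple_derivation A d" "T 1 = d 1"
    using assms(2,4) unfolding local_triple_derivation_def by blast
  have skew: "adj h = - h"
    using triple_derivation_unitary[OF d(1) assms(2)] d(2)
    by (simp add: h_def adj_one eq_neg_iff_add_eq_0 add.commute)
  define T' where "T' = (\<lambda>x. T x - (1/2) *\<^sub>R inner_triple (T 1) 1 x)"
  have T': "T' = (\<lambda>x. T x - (1/2) *\<^sub>R (h * x + x * h))"
    using inner_triple_skew[OF skew] by (simp add: T'_def h_def)
  have half: "T' x = T x - inner_triple ((1/2) *\<^sub>R T 1) 1 x" for x
    by (simp add: T'_def inner_triple_def triple_def adj_scaleR algebra_simps)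
  have T'_one: "T' 1 = 0"
    by (simp add: T' h_def flip: scaleR_2)
  have linT: "clinear_on A T"
    using assms(4) by (simp add: local_triple_derivation_def bounded_clinear_on_def)
  have linT': "clinear_on A T'"
    unfolding T' using triple_derivation_anticommutator[OF skew, of A]
    by (intro clinear_on_diff_scaleR[OF linT]) (simp add: triple_derivation_def)
  obtain K where K: "\<And>x. x \<in> A \<Longrightarrow> norm (T x) \<le> norm x * K"
    using assms(4) by (auto simp: local_triple_derivation_def bounded_clinear_on_def)
  have "norm (T' x) \<le> norm x * (K + norm h)" if "x \<in> A" for x
  proof -
    have "norm (T' x) \<le> norm (T x) + (1/2) * norm (h * x + x * h)"
      unfolding T' using norm_triangle_ineq4[of "T x" "(1/2) *\<^sub>R (h * x + x * h)"] by simp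
    then show ?thesis
      using K[OF that] norm_triangle_ineq[of "h * x" "x * h"] norm_mult_ineq[of h x]
        norm_mult_ineq[of x h] by (simp add: algebra_simps)
  qed
  then have bT': "bounded_clinear_on A T'"
    using linT' unfolding bounded_clinear_on_def by blast
  have "\<exists>e. triple_derivation A e \<and> T' a = e a" if a: "a \<in> A" for a
  proof -
    obtain e where e: "triple_derivation A e" "T a = e a"
      using assms(4) a unfolding local_triple_derivation_def by blast
    show ?thesis
      using triple_derivation_diff_scaleR[OF e(1) triple_derivation_anticommutator[OF skew], of "1/2"]
      by (intro exI[of _ "\<lambda>x. e x - (1/2) *\<^sub>R (h * x + x * h)"]) (simp add: T' e(2))
  qed
  with bT' have locT': "local_triple_derivation A T'"
    by (simp add: local_triple_derivation_def)
  interpret normalised_local_triple_derivation A T'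
    by unfold_locales (use assms bT' locT' T'_one in auto)
  have "T (a * b) = T a * b + a * T b - a * T 1 * b" if "a \<in> A" "b \<in> A" for a b
  proof -
    have T_eq: "T x = T' x + (1/2) *\<^sub>R (h * x + x * h)" for x
      by (simp add: T')
    have leib: "T' (a * b) = T' a * b + a * T' b"
      using derivation_D that by (simp add: derivation_def)
    have split: "a * h * b = (1/2) *\<^sub>R (a * h * b + a * h * b)"
      by (simp flip: scaleR_2)
    have "T a * b + a * T b - a * h * b = T' a * b + a * T' b
        + (1/2) *\<^sub>R ((h * a + a * h) * b + a * (h * b + b * h) - (a * h * b + a * h * b))"
      by (subst split, unfold T_eq[of a] T_eq[of b]) (simp add: algebra_simps)
    also have "(h * a + a * h) * b + a * (h * b + b * h) - (a * h * b + a * h * b)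
        = h * (a * b) + a * b * h"
      by (simp add: algebra_simps)
    finally show ?thesis
      by (simp add: T_eq[of "a * b"] leib h_def)
  qed
  with linT have "generalised_derivation A T"
    by (simp add: generalised_derivation_def)
  moreover have "jordan_derivation A T'"
    by (rule derivation_imp_jordan_derivation[OF assms(1) derivation_D])
  ultimately show ?thesis
    using half locT' T'_one derivation_D unfolding T'_def[symmetric] Let_def by blast
qed

end
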